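(* Fix $d,k\in\mathbb{N}$. Let $\mu$ be a probability measure on $\mathbb{R}^d$ with compact support and with a bounded density with respect to Lebesgue measure. Let $x_1,x_2,\dots$ be i.i.d. samples from $\mu$, let $X_N=\{x_i\}_{i\in[N]}$ be the first $N$ samples, and let $\mu_N=\frac1N\sum_{i\in[N]}\delta_{x_i}$ be the empirical measure. For each $N$, let $A_N\in\{\mathbb{R}^d\}^k$ be a solution of $$\min_{A\in\{\mathbb{R}^d\}^k}F_{\mu_N}(A)\quad\text{subject to}\quad A\subset\mathrm{co}(X_N).$$ Then, almost surely, $(A_N)_{N}$ has a subsequence $(A_{N_m})_m$ that converges in the metric $d_{2,\infty}$ to a limit lying in the solution set of $$\min_{A\in\{\mathbb{R}^d\}^k}F_{\mu}(A)\quad\text{subject to}\quad A\subset\mathrm{co}(\mathrm{supp}(\mu)).\qquad(\ast)$$ If problem $(\ast)$ has a unique solution $A_\star$, then $A_N$ converges to $A_\star$ in $d_{2,\infty}$ almost surely.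
   Context: $[k]=\{1,\dots,k\}$. $\{\mathbb{R}^d\}^k$ denotes the set of unordered collections $A=\{a_\ell\}_{\ell\in[k]}$ of $k$ points of $\mathbb{R}^d$ (repetitions allowed), i.e. $(\mathbb{R}^d)^k$ modulo permutation of components. $\mathrm{co}(\cdot)$ denotes convex hull and $d(x,S)=\inf_{y\in S}\|x-y\|_2$. For a probability measure $\nu$ on $\mathbb{R}^d$, $$F_\nu(A)=\left(\int_{\mathbb{R}^d}d^2(x,\mathrm{co}(A))\,d\nu(x)\right)^{1/2}.$$ The metric $d_{2,\infty}$ on $\{\mathbb{R}^d\}^k$ is $$d_{2,\infty}(\{a_\ell\}_{\ell\in[k]},\{b_\ell\}_{\ell\in[k]})=\min_{\sigma\in S[k]}\max_{\ell\in[k]}\|a_{\sigma(\ell)}-b_\ell\|_2,$$ where $S[k]$ is the set of permutations of $[k]$. "Almost surely" refers to the law of the i.i.d. sequence $(x_i)_{i\ge1}$ (the paper writes "$\mu$-a.s."). *)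

theory Defs
  imports "HOL-Probability.Probability" "HOL-Combinatorics.Combinatorics"
begin

text \<open>
  An unordered collection of \<open>k\<close> points, repetitions allowed, is a multiset of size \<open>k\<close>.
\<close>

definition d2inf_list :: "'a::real_normed_vector list \<Rightarrow> 'a list \<Rightarrow> real" where
  "d2inf_list xs ys =
     Min ((\<lambda>\<sigma>. Max ((\<lambda>l. norm (xs ! \<sigma> l - ys ! l)) ` {..<length ys}))
          ` {\<sigma>. \<sigma> permutes {..<length ys}})"

text \<open>
  Meaningful for nonempty multisets of equal size only. The choice of enumerations is
  immaterial: see \<open>d2inf_mset\<close> below.
\<close>

definition d2inf :: "'a::real_normed_vector multiset \<Rightarrow> 'a multiset \<Rightarrow> real" where
  "d2inf A B = d2inf_list (SOME xs. mset xs = A) (SOME ys. mset ys = B)"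

lemma d2inf_list_perm_left:
  assumes "mset xs = mset xs'" and "length xs = length ys"
  shows "d2inf_list xs ys = d2inf_list xs' ys"
proof -
  let ?P = "{\<sigma>. \<sigma> permutes {..<length ys}}"
  obtain p where p: "p permutes {..<length xs'}" "permute_list p xs' = xs"
    using mset_eq_permutation[OF assms(1)] by metis
  have len: "length xs' = length ys"
    using assms by (metis size_mset)
  have *: "xs ! \<sigma> l = xs' ! ((p \<circ> \<sigma>) l)" if "\<sigma> \<in> ?P" "l < length ys" for \<sigma> l
    using that p len permute_list_nth[OF p(1), of "\<sigma> l"] permutes_in_image[of \<sigma> "{..<length ys}" l]
    by auto
  define m where "m \<sigma> = Max ((\<lambda>l. norm (xs' ! \<sigma> l - ys ! l)) ` {..<length ys})" for \<sigma>
  have "(\<lambda>\<sigma>. Max ((\<lambda>l. norm (xs ! \<sigma> l - ys ! l)) ` {..<length ys})) ` ?P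
        = (\<lambda>\<sigma>. m (p \<circ> \<sigma>)) ` ?P"
    unfolding m_def
    by (intro image_cong refl arg_cong[where f = Max]) (use * in auto)
  also have "\<dots> = m ` ((\<lambda>\<sigma>. p \<circ> \<sigma>) ` ?P)"
    by (simp add: image_image)
  also have "(\<lambda>\<sigma>. p \<circ> \<sigma>) ` ?P = ?P"
    using image_compose_permutations_left[OF p(1)[unfolded len]]
    unfolding image_def by blast
  finally show ?thesis
    unfolding d2inf_list_def m_def by simp
qed

lemma d2inf_list_perm_right:
  assumes "mset ys = mset ys'" and "length xs = length ys"
  shows "d2inf_list xs ys = d2inf_list xs ys'"
proof -
  let ?n = "length ys"
  let ?P = "{\<sigma>. \<sigma> permutes {..<?n}}"
  have len: "length ys' = ?n"
    using assms by (metis size_mset)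
  obtain p where p: "p permutes {..<?n}" "permute_list p ys' = ys"
    using mset_eq_permutation[OF assms(1)] len by metis
  define m where "m \<sigma> = Max ((\<lambda>l. norm (xs ! \<sigma> l - ys ! l)) ` {..<?n})" for \<sigma>
  define m' where "m' \<sigma> = Max ((\<lambda>l. norm (xs ! \<sigma> l - ys' ! l)) ` {..<?n})" for \<sigma>
  have *: "m (\<sigma> \<circ> p) = m' \<sigma>" for \<sigma>
  proof -
    have "(\<lambda>l. norm (xs ! (\<sigma> \<circ> p) l - ys ! l)) ` {..<?n}
          = (\<lambda>l. norm (xs ! \<sigma> (p l) - ys' ! (p l))) ` {..<?n}"
      using p len permute_list_nth[of p ys'] by (intro image_cong) auto
    also have "\<dots> = (\<lambda>l. norm (xs ! \<sigma> l - ys' ! l)) ` (p ` {..<?n})"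
      by (simp add: image_image)
    finally show ?thesis
      unfolding m_def m'_def using permutes_image[OF p(1)] by simp
  qed
  have "m' ` ?P = m ` ((\<lambda>\<sigma>. \<sigma> \<circ> p) ` ?P)"
    by (simp add: image_image *)
  also have "(\<lambda>\<sigma>. \<sigma> \<circ> p) ` ?P = ?P"
    using image_compose_permutations_right[OF p(1)]
    unfolding image_def by blast
  finally show ?thesis
    unfolding d2inf_list_def m_def m'_def len by simp
qed

lemma d2inf_mset:
  assumes "length xs = length ys"
  shows "d2inf (mset xs) (mset ys) = d2inf_list xs ys"
proof -
  define xs' where "xs' = (SOME zs. mset zs = mset xs)"
  define ys' where "ys' = (SOME zs. mset zs = mset ys)"
  have x: "mset xs' = mset xs" unfolding xs'_def by (rule someI) (rule refl)
  have y: "mset ys' = mset ys" unfolding ys'_def by (rule someI) (rule refl)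
  have "length xs' = length xs" "length ys' = length ys"
    using x y by (metis size_mset)+
  then have "d2inf_list xs' ys' = d2inf_list xs ys"
    using d2inf_list_perm_left[OF x] d2inf_list_perm_right[OF y] assms by metis
  then show ?thesis
    unfolding d2inf_def xs'_def ys'_def .
qed

text \<open>
  The integrand is bounded almost everywhere, hence integrable, for every Borel probability
  measure with compact support and every nonempty \<open>A\<close>; otherwise the Bochner integral may take its default value 0.
\<close>

definition Fobj :: "'a::euclidean_space measure \<Rightarrow> 'a multiset \<Rightarrow> real" where
  "Fobj \<nu> A = sqrt (\<integral>x. (infdist x (convex hull (set_mset A)))\<^sup>2 \<partial>\<nu>)"

definition msupp :: "'a::topological_space measure \<Rightarrow> 'a set" where
  "msupp \<nu> = {x. \<forall>U. open U \<and> x \<in> U \<longrightarrow> emeasure \<nu> U > 0}"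

definition has_bounded_density :: "'a::euclidean_space measure \<Rightarrow> bool" where
  "has_bounded_density \<nu> \<longleftrightarrow>
     (\<exists>f\<in>borel_measurable borel. (\<exists>C. \<forall>x. 0 \<le> f x \<and> f x \<le> C) \<and>
        \<nu> = density lborel (\<lambda>x. ennreal (f x)))"

definition empirical_measure :: "nat \<Rightarrow> (nat \<Rightarrow> 'a::topological_space) \<Rightarrow> 'a measure" where
  "empirical_measure N x =
     measure_of UNIV (sets borel)
       (\<lambda>B. ennreal (1 / real N) * (\<Sum>i<N. emeasure (return borel (x i)) B))"

lemma sets_empirical_measure [simp, measurable_cong]:
  "sets (empirical_measure N x) = sets borel"
  unfolding empirical_measure_def by (metis sets.sets_measure_of_eq space_borel)

lemma space_empirical_measure [simp]: "space (empirical_measure N x) = UNIV"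
  unfolding empirical_measure_def by (simp add: space_measure_of_conv)

lemma emeasure_empirical_measure:
  assumes "B \<in> sets borel"
  shows "emeasure (empirical_measure N x) B
         = ennreal (1 / real N) * (\<Sum>i<N. emeasure (return borel (x i)) B)"
proof (rule emeasure_measure_of[OF empirical_measure_def])
  let ?g = "\<lambda>B. ennreal (1 / real N) * (\<Sum>i<N. emeasure (return borel (x i)) B)"
  show "positive (sets (empirical_measure N x)) ?g"
    by (simp add: positive_def)
  show "countably_additive (sets (empirical_measure N x)) ?g"
  proof (rule countably_additiveI)
    fix S :: "nat \<Rightarrow> 'a set"
    assume S: "range S \<subseteq> sets (empirical_measure N x)" "disjoint_family S"
    have "(\<Sum>n. ?g (S n)) = ennreal (1 / real N) * (\<Sum>i<N. \<Sum>n. emeasure (return borel (x i)) (S n))"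
      by (simp add: suminf_sum)
    also have "\<dots> = ?g (\<Union> (range S))"
      using S by (subst suminf_emeasure) auto
    finally show "(\<Sum>n. ?g (S n)) = ?g (\<Union> (range S))" .
  qed
qed (use assms in auto)

text \<open>
  The solution set of the problem of minimising \<open>Fobj \<nu> A\<close> over the \<open>k\<close>-point
  collections \<open>A\<close> contained in the convex hull of \<open>S\<close>.
\<close>

definition solutions :: "nat \<Rightarrow> 'a::euclidean_space measure \<Rightarrow> 'a set \<Rightarrow> 'a multiset set" where
  "solutions k \<nu> S =
     {A. is_arg_min (Fobj \<nu>) (\<lambda>B. size B = k \<and> set_mset B \<subseteq> convex hull S) A}"

end

theory Submission
  imports Defs
begin

text \<open>
  A set of \<open>k\<close> points is enumerated as a list. Moving each point by at most \<open>\<delta>\<close> moves the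
  distance to the convex hull by at most \<open>\<delta>\<close>, so on lists in the compact set
  \<open>K = co(supp \<mu>)\<close> the squared objectives of \<open>\<mu>\<close> and of all empirical measures are
  Lipschitz with the same constant \<open>2 diam K\<close>. Hence the strong law of large numbers
  on a countable dense set of lists (Hoeffding's inequality and Borel-Cantelli) gives,
  almost surely, convergence of the objectives along every convergent sequence of lists. By
  compactness the empirical minimisers have a convergent subsequence. Its limit is
  optimal because the sample is almost surely dense in the support: the projections of
  a competitor onto \<open>co(X\<^sub>N)\<close> are admissible for the empirical problem and converge to
  the competitor.
\<close>

section \<open>Strong law of large numbers for bounded functions of an i.i.d. sample\<close>

text \<open>For fixed \<epsilon>, Hoeffding's inequality makes the probabilities of an
  \<epsilon>-deviation of the mean summable, so by Borel-Cantelli almost surely only finitely many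
  deviations occur.\<close>

lemma (in prob_space) strong_law_iid_bounded:
  fixes Y :: "nat \<Rightarrow> 'a \<Rightarrow> real"
  assumes indep: "indep_vars (\<lambda>_. borel) Y UNIV"
    and distr: "\<And>i. distr M borel (Y i) = distr M borel (Y 0)"
    and bounded: "AE \<omega> in M. Y 0 \<omega> \<in> {a..b}"
    and "a < b"
  shows "AE \<omega> in M. (\<lambda>n. (\<Sum>i<n. Y i \<omega>) / real n) \<longlonglongrightarrow> expectation (Y 0)"
proof -
  have [measurable]: "random_variable borel (Y i)" for i
    using indep unfolding indep_vars_def by blast
  define e where "e = expectation (Y 0)"
  have ev: "AE \<omega> in M. eventually (\<lambda>n. \<bar>(\<Sum>i<n. Y i \<omega>) / real n - e\<bar> < \<epsilon>) sequentially"
    if "\<epsilon> > 0" for \<epsilon>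
  proof -
    define B where "B n = {\<omega>\<in>space M. \<bar>(\<Sum>i<n. Y i \<omega>) / real n - e\<bar> \<ge> \<epsilon>}" for n
    have [measurable]: "B n \<in> sets M" for n
      unfolding B_def by measurable
    \<comment> \<open>The Hoeffding exponent is linear in \<open>n\<close>, so the bound on
      \<open>prob (B n)\<close> is geometric with ratio \<open>q < 1\<close>.\<close>
    define q where "q = exp (-2 * \<epsilon>\<^sup>2 / (b - a)\<^sup>2)"
    have q: "0 \<le> q" "q < 1"
      using \<open>\<epsilon> > 0\<close> \<open>a < b\<close> by (auto simp: q_def)
    have "prob (B n) \<le> 2 * q ^ n" if "n \<ge> 1" for n
    proof -
      interpret Hoeffding_ineq_iid M "{..<n}" Y "Y 0" a b e
        by unfold_locales
          (use assms in \<open>auto simp: e_def intro: indep_vars_subset\<close>)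
      have "{..<n} \<noteq> {}"
        using that by (auto simp: lessThan_empty_iff)
      from Hoeffding_ineq_abs_ge'[of \<epsilon>, OF _ \<open>a < b\<close> this] \<open>\<epsilon> > 0\<close>
      have "prob (B n) \<le> 2 * exp (- 2 * real n * \<epsilon>\<^sup>2 / (b - a)\<^sup>2)"
        by (simp add: B_def)
      also have "exp (- 2 * real n * \<epsilon>\<^sup>2 / (b - a)\<^sup>2) = q ^ n"
        unfolding q_def by (subst exp_of_nat_mult [symmetric]) (simp add: mult_ac)
      finally show ?thesis .
    qed
    then have "norm (prob (B n)) \<le> 2 * q ^ n" if "n \<ge> 1" for n
      using that by simp
    moreover have "summable (\<lambda>n. 2 * q ^ n)"
      using q by (intro summable_mult summable_geometric) auto
    ultimately have "summable (\<lambda>n. prob (B n))"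
      by (rule summable_comparison_test'[rotated])
    then have "AE \<omega> in M. eventually (\<lambda>n. \<omega> \<in> space M - B n) sequentially"
      by (intro borel_cantelli_AE1) (auto simp: emeasure_eq_measure)
    then show ?thesis
      by eventually_elim (auto simp: B_def not_le elim: eventually_mono)
  qed
  \<comment> \<open>The null set in \<open>ev\<close> depends on \<epsilon>; the countably many
    values \<open>inverse (Suc m)\<close> give a common one.\<close>
  have "AE \<omega> in M. \<forall>m. eventually (\<lambda>n. \<bar>(\<Sum>i<n. Y i \<omega>) / real n - e\<bar> < inverse (real (Suc m))) sequentially"
    unfolding AE_all_countable by (intro allI ev) auto
  then show ?thesis
    unfolding e_def [symmetric]
  proof eventually_elim
    case (elim \<omega>)
    show ?case
    proof (rule tendstoI)
      fix r :: real assume "r > 0"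
      then obtain m where "inverse (real (Suc m)) < r"
        using reals_Archimedean by blast
      with elim[rule_format, of m]
      show "\<forall>\<^sub>F n in sequentially. dist ((\<Sum>i<n. Y i \<omega>) / real n) e < r"
        by (auto simp: dist_real_def elim!: eventually_mono)
    qed
  qed
qed

text \<open>Boundedness is asked only almost everywhere under \<open>\<mu>\<close>, so that squared
  distances, unbounded on the whole space, qualify when \<open>\<mu>\<close> has compact
  support.\<close>

lemma (in prob_space) strong_law_bounded_function:
  fixes X :: "nat \<Rightarrow> 'a \<Rightarrow> 'b::topological_space" and h :: "'b \<Rightarrow> real"
  assumes indep: "indep_vars (\<lambda>_. borel) X UNIV"
    and distr: "\<And>i. distr M borel (X i) = \<mu>"
    and h [measurable]: "h \<in> borel_measurable borel"
    and bounded: "AE x in \<mu>. h x \<in> {a..b}"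
    and "a < b"
  shows "AE \<omega> in M. (\<lambda>n. (\<Sum>i<n. h (X i \<omega>)) / real n) \<longlonglongrightarrow> (\<integral>x. h x \<partial>\<mu>)"
proof -
  have X [measurable]: "random_variable borel (X i)" for i
    using indep unfolding indep_vars_def by blast
  have "AE \<omega> in M. (\<lambda>n. (\<Sum>i<n. h (X i \<omega>)) / real n) \<longlonglongrightarrow> expectation (\<lambda>\<omega>. h (X 0 \<omega>))"
  proof (rule strong_law_iid_bounded[OF _ _ _ \<open>a < b\<close>])
    show "indep_vars (\<lambda>_. borel) (\<lambda>i \<omega>. h (X i \<omega>)) UNIV"
      by (rule indep_vars_compose2[OF indep]) (rule h)
    have "distr M borel (\<lambda>\<omega>. h (X i \<omega>)) = distr \<mu> borel h" for i
      unfolding distr[of i, symmetric] by (subst distr_distr) (auto simp: comp_def)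
    then show "distr M borel (\<lambda>\<omega>. h (X i \<omega>)) = distr M borel (\<lambda>\<omega>. h (X 0 \<omega>))" for i
      by simp
    show "AE \<omega> in M. h (X 0 \<omega>) \<in> {a..b}"
      using bounded unfolding distr[of 0, symmetric] by (subst (asm) AE_distr_iff) auto
  qed
  also have "expectation (\<lambda>\<omega>. h (X 0 \<omega>)) = (\<integral>x. h x \<partial>\<mu>)"
    unfolding distr[of 0, symmetric] by (subst integral_distr) auto
  finally show ?thesis .
qed

section \<open>Empirical measures and the support\<close>

text \<open>Drawing a uniformly random index below \<open>N\<close> and evaluating \<open>x\<close>
  there has the empirical measure as its law. Integrals and almost-everywhere statements thereby
  reduce to those of a finite uniform distribution.\<close>

lemma empirical_measure_eq_distr_pmf_of_set:
  assumes "N \<ge> 1"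
  shows "empirical_measure N x = distr (measure_pmf (pmf_of_set {..<N})) borel x"
proof (rule measure_eqI)
  fix B assume "B \<in> sets (empirical_measure N x)"
  then have B: "B \<in> sets borel" by simp
  have ne: "{..<N} \<noteq> {}" using assms by (auto simp: lessThan_empty_iff)
  have "(\<Sum>i<N. emeasure (return borel (x i)) B) = (\<Sum>i<N. indicator (x -` B) i)"
    using B by (intro sum.cong) (auto simp: indicator_def)
  also have "\<dots> = of_nat (card ({..<N} \<inter> x -` B))"
    by (simp add: sum.If_cases indicator_def vimage_def)
  finally show "emeasure (empirical_measure N x) B
      = emeasure (distr (measure_pmf (pmf_of_set {..<N})) borel x) B"
    using B assms ne
    by (simp add: emeasure_empirical_measure emeasure_distr emeasure_pmf_of_set
        ennreal_of_nat_eq_real_of_nat flip: ennreal_mult')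
qed simp

lemma integral_empirical_measure:
  fixes h :: "'a::topological_space \<Rightarrow> real"
  assumes "N \<ge> 1" and [measurable]: "h \<in> borel_measurable borel"
  shows "(\<integral>x. h x \<partial>empirical_measure N z) = (\<Sum>i<N. h (z i)) / real N"
proof -
  have "{..<N} \<noteq> {}" using assms(1) by (auto simp: lessThan_empty_iff)
  then show ?thesis
    using assms(1) by (simp add: empirical_measure_eq_distr_pmf_of_set integral_distr integral_pmf_of_set)
qed

lemma msupp_closed: "closed (msupp \<nu>)"
proof -
  have "- msupp \<nu> = \<Union>{U. open U \<and> emeasure \<nu> U = 0}"
    unfolding msupp_def by auto
  then show ?thesis
    unfolding closed_def by (metis (mono_tags, lifting) mem_Collect_eq open_Union)
qed

text \<open>The complement of the support is a union of possibly uncountably many open null sets; a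
  countable basis reduces it to countably many basic null sets.\<close>

lemma AE_in_msupp:
  fixes \<nu> :: "'a::second_countable_topology measure"
  assumes "sets \<nu> = sets borel"
  shows "AE x in \<nu>. x \<in> msupp \<nu>"
proof -
  obtain \<B> :: "'a set set" where \<B>: "countable \<B>" "topological_basis \<B>"
    using ex_countable_basis by blast
  define \<N> where "\<N> = {U \<in> \<B>. emeasure \<nu> U = 0}"
  have "- msupp \<nu> \<subseteq> \<Union>\<N>"
  proof
    fix x assume "x \<in> - msupp \<nu>"
    then obtain U where U: "open U" "x \<in> U" "emeasure \<nu> U = 0"
      unfolding msupp_def by auto
    obtain B where B: "B \<in> \<B>" "x \<in> B" "B \<subseteq> U"
      using topological_basisE[OF \<B>(2) U(1,2)] by blast
    have "emeasure \<nu> B \<le> emeasure \<nu> U"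
      using B U assms by (intro emeasure_mono) auto
    then show "x \<in> \<Union>\<N>"
      using B U by (auto simp: \<N>_def)
  qed
  moreover have "\<Union>\<N> \<in> null_sets \<nu>"
  proof -
    have "(\<Union>B\<in>\<N>. B) \<in> null_sets \<nu>"
    proof (rule null_sets_UN')
      show "countable \<N>" using \<B>(1) by (simp add: \<N>_def)
      show "B \<in> null_sets \<nu>" if "B \<in> \<N>" for B
        using that topological_basis_open[OF \<B>(2)] assms by (auto simp: \<N>_def null_sets_def)
    qed
    then show ?thesis by simp
  qed
  ultimately show ?thesis
    by (intro AE_I'[of "\<Union>\<N>"]) auto
qed

text \<open>The strong law is applied to the indicators of countably many basic open sets. A support
  point away from the sample would have a basic neighbourhood that no sample visits; its frequency
  is 0, so its measure is 0, which the support forbids.\<close>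

lemma (in prob_space) AE_msupp_subset_closure_sample:
  fixes X :: "nat \<Rightarrow> 'a \<Rightarrow> 'b::second_countable_topology"
  assumes indep: "indep_vars (\<lambda>_. borel) X UNIV"
    and distr: "\<And>i. distr M borel (X i) = \<mu>"
  shows "AE \<omega> in M. msupp \<mu> \<subseteq> closure (range (\<lambda>i. X i \<omega>))"
proof -
  have X [measurable]: "random_variable borel (X i)" for i
    using indep unfolding indep_vars_def by blast
  have sets: "sets \<mu> = sets borel"
    unfolding distr[of 0, symmetric] by simp
  interpret \<mu>: prob_space \<mu>
    unfolding distr[of 0, symmetric] by (rule prob_space_distr) (rule X)
  obtain \<B> :: "'b set set" where \<B>: "countable \<B>" "topological_basis \<B>"
    using ex_countable_basis by blast
  have open_\<B>: "open U" if "U \<in> \<B>" for U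
    using topological_basis_open[OF \<B>(2) that] .
  have "AE \<omega> in M. (\<lambda>n. (\<Sum>i<n. indicat_real U (X i \<omega>)) / real n) \<longlonglongrightarrow> (\<integral>x. indicat_real U x \<partial>\<mu>)"
    if "U \<in> \<B>" for U
    using open_\<B>[OF that]
    by (intro strong_law_bounded_function[OF indep distr, where a = 0 and b = 1])
       (auto split: split_indicator)
  then have "AE \<omega> in M. \<forall>U\<in>\<B>. (\<lambda>n. (\<Sum>i<n. indicat_real U (X i \<omega>)) / real n) \<longlonglongrightarrow> measure \<mu> U"
    using open_\<B> sets \<B>(1) by (subst AE_ball_countable) auto
  then show ?thesis
  proof eventually_elim
    case (elim \<omega>)
    show ?case
    proof
      fix x assume x: "x \<in> msupp \<mu>"
      show "x \<in> closure (range (\<lambda>i. X i \<omega>))"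
      proof (rule ccontr)
        assume "x \<notin> closure (range (\<lambda>i. X i \<omega>))"
        then obtain U where U: "U \<in> \<B>" "x \<in> U" "U \<subseteq> - closure (range (\<lambda>i. X i \<omega>))"
          using topological_basisE[OF \<B>(2), of "- closure (range (\<lambda>i. X i \<omega>))" x] by auto
        have "X i \<omega> \<notin> U" for i
          using U(3) closure_subset[of "range (\<lambda>i. X i \<omega>)"] by blast
        then have "(\<lambda>n. 0) \<longlonglongrightarrow> measure \<mu> U"
          using elim U(1) by (auto simp: indicator_def)
        then have "measure \<mu> U = 0"
          by (simp add: LIMSEQ_const_iff)
        moreover have "emeasure \<mu> U > 0"
          using x U(2) open_\<B>[OF U(1)] unfolding msupp_def by blast
        ultimately show False
          by (simp add: \<mu>.emeasure_eq_measure)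
      qed
    qed
  qed
qed

section \<open>Lipschitz dependence of the objective on the points\<close>

text \<open>The Minkowski sum \<open>?C\<close> of the hull of \<open>xs\<close> and a ball of
  radius \<delta> is convex and contains every entry of \<open>ys\<close>, hence the whole hull of
  \<open>ys\<close>. The point of that hull nearest to \<open>x\<close> is therefore within \<delta>
  of the hull of \<open>xs\<close>.\<close>

lemma infdist_convex_hull_list_le:
  fixes xs ys :: "'a::euclidean_space list"
  assumes "length xs = length ys" and "ys \<noteq> []"
    and close: "\<And>l. l < length ys \<Longrightarrow> dist (xs ! l) (ys ! l) \<le> \<delta>"
  shows "infdist x (convex hull set xs) \<le> infdist x (convex hull set ys) + \<delta>"
proof -
  let ?C = "\<Union>a\<in>convex hull set xs. \<Union>v\<in>cball 0 \<delta>. {a + v}"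
  have "set ys \<subseteq> ?C"
  proof
    fix y assume "y \<in> set ys"
    then obtain l where l: "l < length ys" "y = ys ! l"
      by (auto simp: in_set_conv_nth)
    then have "xs ! l \<in> convex hull set xs"
      using assms(1) by (intro hull_inc) simp
    moreover have "ys ! l - xs ! l \<in> cball 0 \<delta>"
      using close[OF l(1)] by (simp add: dist_norm norm_minus_commute)
    moreover have "y = xs ! l + (ys ! l - xs ! l)"
      using l by simp
    ultimately show "y \<in> ?C" by blast
  qed
  then have "convex hull set ys \<subseteq> ?C"
    by (intro hull_minimal convex_sums) auto
  moreover obtain y where y: "y \<in> convex hull set ys" "infdist x (convex hull set ys) = dist x y"
    using infdist_attains_inf[of "convex hull set ys" x] \<open>ys \<noteq> []\<close>
      finite_imp_compact_convex_hull[of "set ys"] by (auto simp: compact_imp_closed)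
  ultimately obtain a v where a: "a \<in> convex hull set xs" "norm v \<le> \<delta>" "y = a + v"
    by auto
  have "infdist x (convex hull set xs) \<le> dist x a"
    using a(1) by (rule infdist_le)
  also have "\<dots> \<le> dist x y + dist y a"
    by (rule dist_triangle)
  finally show ?thesis
    using a y(2) by (simp add: dist_norm)
qed

lemma infdist_convex_hull_le_diameter:
  fixes K :: "'a::euclidean_space set"
  assumes "compact K" "convex K" "x \<in> K" "set xs \<subseteq> K" "xs \<noteq> []"
  shows "infdist x (convex hull set xs) \<le> diameter K"
proof -
  have "hd xs \<in> convex hull set xs"
    using \<open>xs \<noteq> []\<close> by (intro hull_inc) simp
  moreover have "dist x (hd xs) \<le> diameter K"
    using assms by (intro diameter_bounded_bound compact_imp_bounded) auto
  ultimately show ?thesis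
    by (rule infdist_le2)
qed

text \<open>Factor the difference of squares: the distances differ by at most \<delta>, and each of
  them is at most the diameter of \<open>K\<close>.\<close>

lemma infdist_convex_hull_square_diff_le:
  fixes K :: "'a::euclidean_space set"
  assumes K: "compact K" "convex K" "x \<in> K" "set xs \<subseteq> K" "set ys \<subseteq> K"
    and len: "length xs = length ys" "ys \<noteq> []"
    and close: "\<And>l. l < length ys \<Longrightarrow> dist (xs ! l) (ys ! l) \<le> \<delta>"
  shows "\<bar>(infdist x (convex hull set xs))\<^sup>2 - (infdist x (convex hull set ys))\<^sup>2\<bar>
           \<le> 2 * diameter K * \<delta>"
proof -
  define a where "a = infdist x (convex hull set xs)"
  define b where "b = infdist x (convex hull set ys)"
  have "xs \<noteq> []" using len by auto
  have "0 \<le> a" "0 \<le> b" "a \<le> diameter K" "b \<le> diameter K"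
    unfolding a_def b_def
    using infdist_convex_hull_le_diameter K len(2) \<open>xs \<noteq> []\<close> by (auto simp: infdist_nonneg)
  moreover have "a \<le> b + \<delta>" "b \<le> a + \<delta>"
    unfolding a_def b_def
    using infdist_convex_hull_list_le[of xs ys \<delta> x] infdist_convex_hull_list_le[of ys xs \<delta> x]
      len \<open>xs \<noteq> []\<close> close by (auto simp: dist_commute)
  ultimately have "\<bar>a - b\<bar> * (a + b) \<le> \<delta> * (2 * diameter K)"
    by (intro mult_mono) auto
  then have "\<bar>(a - b) * (a + b)\<bar> \<le> 2 * diameter K * \<delta>"
    using \<open>0 \<le> a\<close> \<open>0 \<le> b\<close> by (simp add: abs_mult mult_ac)
  then show ?thesis
    unfolding a_def [symmetric] b_def [symmetric]
    by (simp add: power2_eq_square algebra_simps)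
qed

text \<open>The square of \<open>Fobj\<close>, on enumerated points: lists allow convergence
  position by position, and without the root the objective is an integral to which the law of large
  numbers applies.\<close>

abbreviation mean_sq_dist :: "'a::euclidean_space measure \<Rightarrow> 'a list \<Rightarrow> real" where
  "mean_sq_dist \<nu> xs \<equiv> \<integral>x. (infdist x (convex hull set xs))\<^sup>2 \<partial>\<nu>"

lemma borel_measurable_infdist_square [measurable]:
  "(\<lambda>x. (infdist x C)\<^sup>2) \<in> borel_measurable borel"
  by (intro borel_measurable_continuous_onI continuous_intros)

lemma Fobj_mset: "Fobj \<nu> (mset xs) = sqrt (mean_sq_dist \<nu> xs)"
  by (simp add: Fobj_def)

text \<open>The pointwise bound is integrated against a probability measure, so the constant is the
  same for every \<open>\<nu>\<close> concentrated on \<open>K\<close>.\<close>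

lemma mean_sq_dist_diff_le:
  fixes K :: "'a::euclidean_space set"
  assumes "prob_space \<nu>" and sets [measurable_cong]: "sets \<nu> = sets borel"
    and AE: "AE x in \<nu>. x \<in> K"
    and K: "compact K" "convex K" "set xs \<subseteq> K" "set ys \<subseteq> K"
    and len: "length xs = length ys" "ys \<noteq> []"
    and close: "\<And>l. l < length ys \<Longrightarrow> dist (xs ! l) (ys ! l) \<le> \<delta>"
  shows "\<bar>mean_sq_dist \<nu> xs - mean_sq_dist \<nu> ys\<bar> \<le> 2 * diameter K * \<delta>"
proof -
  interpret prob_space \<nu> by fact
  have int: "integrable \<nu> (\<lambda>x. (infdist x (convex hull set zs))\<^sup>2)"
    if "set zs \<subseteq> K" "zs \<noteq> []" for zs
  proof (rule integrable_const_bound)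
    show "AE x in \<nu>. norm ((infdist x (convex hull set zs))\<^sup>2) \<le> (diameter K)\<^sup>2"
      using AE
      by eventually_elim
        (auto intro!: power_mono infdist_convex_hull_le_diameter K that simp: infdist_nonneg)
  qed simp
  have [simp]: "xs \<noteq> []" using len by auto
  have "mean_sq_dist \<nu> xs - mean_sq_dist \<nu> ys =
      (\<integral>x. (infdist x (convex hull set xs))\<^sup>2 - (infdist x (convex hull set ys))\<^sup>2 \<partial>\<nu>)"
    using int K len by simp
  also have "\<bar>\<dots>\<bar> \<le> (\<integral>x. \<bar>(infdist x (convex hull set xs))\<^sup>2 - (infdist x (convex hull set ys))\<^sup>2\<bar> \<partial>\<nu>)"
    by (rule integral_abs_bound)
  also have "\<dots> \<le> 2 * diameter K * \<delta>"
  proof (rule integral_le_const)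
    show "integrable \<nu> (\<lambda>x. \<bar>(infdist x (convex hull set xs))\<^sup>2 - (infdist x (convex hull set ys))\<^sup>2\<bar>)"
      using int K len by simp
    show "AE x in \<nu>. \<bar>(infdist x (convex hull set xs))\<^sup>2 - (infdist x (convex hull set ys))\<^sup>2\<bar>
        \<le> 2 * diameter K * \<delta>"
      using AE by eventually_elim (intro infdist_convex_hull_square_diff_le K len close)
  qed
  finally show ?thesis .
qed

section \<open>The metric \<open>d2inf\<close> and compactness for lists\<close>

text \<open>Matching equal positions, the identity permutation, is one candidate in the
  minimum.\<close>

lemma d2inf_mset_le:
  assumes "length xs = length ys" "ys \<noteq> []"
    and close: "\<And>l. l < length ys \<Longrightarrow> dist (xs ! l) (ys ! l) \<le> \<delta>"
  shows "d2inf (mset xs) (mset ys) \<le> \<delta>"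
proof -
  have "d2inf_list xs ys \<le> Max ((\<lambda>l. norm (xs ! id l - ys ! l)) ` {..<length ys})"
    unfolding d2inf_list_def by (intro Min_le image_eqI[where x = id]) (auto simp: finite_permutations permutes_id)
  also have "\<dots> \<le> \<delta>"
    using assms by (subst Max_le_iff) (auto simp: dist_norm lessThan_empty_iff)
  finally show ?thesis
    using assms(1) by (simp add: d2inf_mset)
qed

lemma d2inf_mset_nonneg:
  assumes "length xs = length ys" "ys \<noteq> []"
  shows "0 \<le> d2inf (mset xs) (mset ys)"
proof -
  have "0 \<le> Max ((\<lambda>l. norm (xs ! \<sigma> l - ys ! l)) ` {..<length ys})" for \<sigma>
    using assms(2) by (subst Max_ge_iff) (auto simp: lessThan_empty_iff)
  then have "0 \<le> d2inf_list xs ys"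
    unfolding d2inf_list_def
    by (subst Min_ge_iff) (auto simp: finite_permutations intro: permutes_id)
  then show ?thesis
    using assms(1) by (simp add: d2inf_mset)
qed

text \<open>The sum of the distances at all positions dominates their maximum and tends to 0 term by
  term.\<close>

lemma tendsto_d2inf_mset:
  assumes len: "\<And>n. length (xs n) = length ys" "ys \<noteq> []"
    and lim: "\<And>l. l < length ys \<Longrightarrow> (\<lambda>n. xs n ! l) \<longlonglongrightarrow> ys ! l"
  shows "(\<lambda>n. d2inf (mset (xs n)) (mset ys)) \<longlonglongrightarrow> 0"
proof (rule tendsto_sandwich)
  show "\<forall>\<^sub>F n in sequentially. 0 \<le> d2inf (mset (xs n)) (mset ys)"
    by (simp add: d2inf_mset_nonneg len)
  show "\<forall>\<^sub>F n in sequentially.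
      d2inf (mset (xs n)) (mset ys) \<le> (\<Sum>l<length ys. dist (xs n ! l) (ys ! l))"
    by (intro always_eventually allI d2inf_mset_le len) (auto intro!: member_le_sum)
  show "(\<lambda>n. \<Sum>l<length ys. dist (xs n ! l) (ys ! l)) \<longlonglongrightarrow> 0"
    using lim by (intro tendsto_null_sum) (simp add: tendsto_dist_iff [symmetric])
qed simp

text \<open>Sequential compactness of the \<open>k\<close>-fold product of \<open>K\<close>, by
  induction: choose a subsequence along which the tails converge, then a further one for the heads,
  which preserves the limits of the tails.\<close>

lemma compact_list_subsequence:
  fixes xs :: "nat \<Rightarrow> 'a::metric_space list"
  assumes "compact K" and xs: "\<And>n. length (xs n) = k" "\<And>n. set (xs n) \<subseteq> K"
  shows "\<exists>r ys. strict_mono (r :: nat \<Rightarrow> nat) \<and> length ys = k \<and> set ys \<subseteq> K \<and>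
      (\<forall>l<k. (\<lambda>n. xs (r n) ! l) \<longlonglongrightarrow> ys ! l)"
  using xs
proof (induction k arbitrary: xs)
  case 0
  then show ?case by (auto intro!: exI[of _ id] strict_mono_id)
next
  case (Suc k)
  have len: "length (xs n) = Suc k" for n
    by (rule Suc.prems)
  have ne: "xs n \<noteq> []" for n
    using len[of n] by auto
  then have hd_tl: "xs n = hd (xs n) # tl (xs n)" for n
    by simp
  have "set (tl (xs n)) \<subseteq> K" for n
    using Suc.prems(2)[of n] hd_tl[of n] by (metis set_subset_Cons subset_trans)
  then obtain r ys where r: "strict_mono (r :: nat \<Rightarrow> nat)" "length ys = k" "set ys \<subseteq> K"
      "\<forall>l<k. (\<lambda>n. tl (xs (r n)) ! l) \<longlonglongrightarrow> ys ! l"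
    using Suc.IH[of "\<lambda>n. tl (xs n)"] Suc.prems(1) by auto
  have "hd (xs (r n)) \<in> K" for n
    using Suc.prems(2)[of "r n"] hd_tl[of "r n"] by (metis list.set_intros(1) subsetD)
  then obtain y s where s: "y \<in> K" "strict_mono (s :: nat \<Rightarrow> nat)"
      "((\<lambda>n. hd (xs (r n))) \<circ> s) \<longlonglongrightarrow> y"
    using \<open>compact K\<close> unfolding compact_def by metis
  have "(\<lambda>n. xs ((r \<circ> s) n) ! l) \<longlonglongrightarrow> (y # ys) ! l" if "l < Suc k" for l
  proof (cases l)
    case 0
    then show ?thesis
      using s(3) ne by (simp add: comp_def hd_conv_nth)
  next
    case (Suc j)
    then have "(\<lambda>n. tl (xs (r n)) ! j) \<longlonglongrightarrow> ys ! j"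
      using r(4) that by simp
    from LIMSEQ_subseq_LIMSEQ[OF this s(2)] show ?thesis
      using Suc len ne that by (simp add: comp_def nth_tl)
  qed
  moreover have "strict_mono (r \<circ> s)"
    using r(1) s(2) by (rule strict_mono_o)
  ultimately show ?case
    using r(2,3) s(1) by (intro exI[of _ "r \<circ> s"] exI[of _ "y # ys"]) (simp del: o_apply)
qed

section \<open>Concentration of empirical measures, and a criterion for convergence\<close>

lemma prob_space_empirical_measure:
  assumes "N \<ge> 1"
  shows "prob_space (empirical_measure N z)"
  using assms
  by (simp add: empirical_measure_eq_distr_pmf_of_set measure_pmf.prob_space_distr)

lemma AE_empirical_measure_in:
  assumes "N \<ge> 1" "range z \<subseteq> K" and [measurable]: "K \<in> sets borel"
  shows "AE x in empirical_measure N z. x \<in> K"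
  unfolding empirical_measure_eq_distr_pmf_of_set[OF assms(1)]
  by (subst AE_distr_iff) (use assms(2) in auto)

text \<open>An argument with three errors: from \<open>f n\<close> to \<open>g n\<close>, from
  \<open>g n\<close> to \<open>b\<close>, and from \<open>b\<close> to \<open>a\<close>. It turns
  the Lipschitz bounds into convergence.\<close>

lemma tendsto_from_uniform_approximation:
  fixes f :: "nat \<Rightarrow> real"
  assumes "C \<ge> 0"
    and approx: "\<And>\<epsilon>. \<epsilon> > 0 \<Longrightarrow> \<exists>g b. g \<longlonglongrightarrow> b \<and> \<bar>b - a\<bar> \<le> C * \<epsilon> \<and> (\<forall>\<^sub>F n in sequentially. \<bar>f n - g n\<bar> \<le> C * \<epsilon>)"
  shows "f \<longlonglongrightarrow> a"
proof (rule tendstoI)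
  fix r :: real assume "r > 0"
  \<comment> \<open>Dividing by \<open>C + 1\<close> rather than \<open>C\<close> covers
    \<open>C = 0\<close>, which occurs when \<open>K\<close> is a single point.\<close>
  define \<epsilon> where "\<epsilon> = r / (3 * (C + 1))"
  have "\<epsilon> > 0" using \<open>r > 0\<close> \<open>C \<ge> 0\<close> by (simp add: \<epsilon>_def)
  have "C * \<epsilon> < (C + 1) * \<epsilon>"
    using \<open>\<epsilon> > 0\<close> by simp
  also have "\<dots> = r / 3"
    using \<open>C \<ge> 0\<close> by (simp add: \<epsilon>_def field_simps add_eq_0_iff)
  finally have small: "C * \<epsilon> < r / 3" .
  obtain g b where g: "g \<longlonglongrightarrow> b" "\<bar>b - a\<bar> \<le> C * \<epsilon>" "\<forall>\<^sub>F n in sequentially. \<bar>f n - g n\<bar> \<le> C * \<epsilon>"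
    using approx[OF \<open>\<epsilon> > 0\<close>] by blast
  have "\<forall>\<^sub>F n in sequentially. dist (g n) b < r / 3"
    using g(1) \<open>r > 0\<close> by (intro tendstoD) auto
  with g(3) show "\<forall>\<^sub>F n in sequentially. dist (f n) a < r"
    by eventually_elim (use g(2) small in \<open>unfold dist_real_def, linarith\<close>)
qed

section \<open>Deterministic convergence along one sample path\<close>

text \<open>Collects the properties that hold for almost every sample path \<open>z\<close>, so that
  everything inside is free of probability on the sample space. \<open>S\<close> stands for the
  support, and \<open>D\<close> for a dense subset of its hull on which the law of large numbers is
  available.\<close>

locale consistent_sample =
  fixes k :: nat and \<mu> :: "'a::euclidean_space measure" and S D :: "'a set" and z :: "nat \<Rightarrow> 'a"
  assumes k: "k \<ge> 1"
    and prob_space_\<mu>: "prob_space \<mu>"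
    and sets_\<mu>: "sets \<mu> = sets borel"
    and compact_S: "compact S"
    and AE_S: "AE x in \<mu>. x \<in> S"
    and sample_in: "range z \<subseteq> S"
    and sample_dense: "S \<subseteq> closure (range z)"
    and D_subset: "D \<subseteq> convex hull S"
    and D_dense: "convex hull S \<subseteq> closure D"
    and law_on_D: "\<And>ys. length ys = k \<Longrightarrow> set ys \<subseteq> D \<Longrightarrow>
          (\<lambda>N. (\<Sum>i<N. (infdist (z i) (convex hull set ys))\<^sup>2) / real N) \<longlonglongrightarrow> mean_sq_dist \<mu> ys"
begin

abbreviation K :: "'a set" where "K \<equiv> convex hull S"

abbreviation emp :: "nat \<Rightarrow> 'a measure" where "emp N \<equiv> empirical_measure N z"

lemma compact_K: "compact K"
  using compact_S by (rule compact_convex_hull)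

lemma AE_K: "AE x in \<mu>. x \<in> K"
  using AE_S by eventually_elim (rule hull_inc)

lemma AE_emp_K: "N \<ge> 1 \<Longrightarrow> AE x in emp N. x \<in> K"
  using sample_in hull_subset[of S convex] compact_K
  by (intro AE_empirical_measure_in) (auto intro: borel_compact)

lemma diameter_K_nonneg: "0 \<le> diameter K"
  using compact_K by (intro diameter_ge_0 compact_imp_bounded)

lemma mean_sq_dist_diff_le_\<mu>:
  assumes "length xs = k" "length ys = k" "set xs \<subseteq> K" "set ys \<subseteq> K"
    and "\<And>l. l < k \<Longrightarrow> dist (xs ! l) (ys ! l) \<le> \<delta>"
  shows "\<bar>mean_sq_dist \<mu> xs - mean_sq_dist \<mu> ys\<bar> \<le> 2 * diameter K * \<delta>"
  using k assms compact_K
  by (intro mean_sq_dist_diff_le prob_space_\<mu> sets_\<mu> AE_K) auto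

lemma mean_sq_dist_diff_le_emp:
  assumes "N \<ge> 1" "length xs = k" "length ys = k" "set xs \<subseteq> K" "set ys \<subseteq> K"
    and "\<And>l. l < k \<Longrightarrow> dist (xs ! l) (ys ! l) \<le> \<delta>"
  shows "\<bar>mean_sq_dist (emp N) xs - mean_sq_dist (emp N) ys\<bar> \<le> 2 * diameter K * \<delta>"
  using k assms compact_K
  by (intro mean_sq_dist_diff_le prob_space_empirical_measure sets_empirical_measure AE_emp_K) auto

text \<open>Extends \<open>law_on_D\<close> to all lists in \<open>K\<close>: replacing the entries
  by nearby points of \<open>D\<close> costs the same Lipschitz error for \<open>\<mu>\<close> and
  for each empirical measure.\<close>

lemma tendsto_mean_sq_dist:
  assumes xs: "length xs = k" "set xs \<subseteq> K"
  shows "(\<lambda>N. mean_sq_dist (emp N) xs) \<longlonglongrightarrow> mean_sq_dist \<mu> xs"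
proof (rule tendsto_from_uniform_approximation[where C = "2 * diameter K"])
  fix \<epsilon> :: real assume "\<epsilon> > 0"
  have "\<exists>y. y \<in> D \<and> dist (xs ! l) y \<le> \<epsilon>" if "l < k" for l
  proof -
    have "xs ! l \<in> closure D"
      using that xs D_dense nth_mem[of l xs] by blast
    then show ?thesis
      using \<open>\<epsilon> > 0\<close> by (metis closure_approachable dist_commute less_imp_le)
  qed
  then obtain y where y: "\<And>l. l < k \<Longrightarrow> y l \<in> D" "\<And>l. l < k \<Longrightarrow> dist (xs ! l) (y l) \<le> \<epsilon>"
    by metis
  define ys where "ys = map y [0..<k]"
  have ys: "length ys = k" "set ys \<subseteq> D" "\<And>l. l < k \<Longrightarrow> dist (xs ! l) (ys ! l) \<le> \<epsilon>"
    using y by (auto simp: ys_def)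
  have "set ys \<subseteq> K"
    using ys(2) D_subset by blast
  have "\<forall>\<^sub>F N in sequentially.
      (\<Sum>i<N. (infdist (z i) (convex hull set ys))\<^sup>2) / real N = mean_sq_dist (emp N) ys"
    using eventually_ge_at_top[of 1]
    by eventually_elim (simp add: integral_empirical_measure)
  from Lim_transform_eventually[OF law_on_D[OF ys(1,2)] this]
  have "(\<lambda>N. mean_sq_dist (emp N) ys) \<longlonglongrightarrow> mean_sq_dist \<mu> ys" .
  moreover have "\<bar>mean_sq_dist \<mu> ys - mean_sq_dist \<mu> xs\<bar> \<le> 2 * diameter K * \<epsilon>"
    using mean_sq_dist_diff_le_\<mu>[OF xs(1) ys(1) xs(2) \<open>set ys \<subseteq> K\<close> ys(3)] by linarith
  moreover have "\<forall>\<^sub>F N in sequentially.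
      \<bar>mean_sq_dist (emp N) xs - mean_sq_dist (emp N) ys\<bar> \<le> 2 * diameter K * \<epsilon>"
    using eventually_ge_at_top[of 1]
    by eventually_elim (intro mean_sq_dist_diff_le_emp xs ys \<open>set ys \<subseteq> K\<close>)
  ultimately show "\<exists>g b. g \<longlonglongrightarrow> b \<and> \<bar>b - mean_sq_dist \<mu> xs\<bar> \<le> 2 * diameter K * \<epsilon> \<and>
      (\<forall>\<^sub>F N in sequentially. \<bar>mean_sq_dist (emp N) xs - g N\<bar> \<le> 2 * diameter K * \<epsilon>)"
    by blast
qed (use diameter_K_nonneg in simp)

text \<open>Measure and list vary together. Since the Lipschitz constant is uniform over the
  empirical measures, \<open>xs n\<close> may be replaced by its limit \<open>ys\<close>, to which
  the previous lemma applies.\<close>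

lemma tendsto_mean_sq_dist_diagonal:
  assumes p: "filterlim p sequentially sequentially" "\<And>n. p n \<ge> 1"
    and xs: "\<And>n. length (xs n) = k" "\<And>n. set (xs n) \<subseteq> K"
    and ys: "length ys = k" "set ys \<subseteq> K"
    and lim: "\<And>l. l < k \<Longrightarrow> (\<lambda>n. xs n ! l) \<longlonglongrightarrow> ys ! l"
  shows "(\<lambda>n. mean_sq_dist (emp (p n)) (xs n)) \<longlonglongrightarrow> mean_sq_dist \<mu> ys"
proof (rule tendsto_from_uniform_approximation[where C = "2 * diameter K"])
  fix \<epsilon> :: real assume "\<epsilon> > 0"
  have "\<forall>\<^sub>F n in sequentially. \<forall>l\<in>{..<k}. dist (xs n ! l) (ys ! l) < \<epsilon>"
    using lim \<open>\<epsilon> > 0\<close> by (intro eventually_ball_finite ballI tendstoD) auto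
  then have "\<forall>\<^sub>F n in sequentially.
      \<bar>mean_sq_dist (emp (p n)) (xs n) - mean_sq_dist (emp (p n)) ys\<bar> \<le> 2 * diameter K * \<epsilon>"
    by eventually_elim (intro mean_sq_dist_diff_le_emp p xs ys, auto intro: less_imp_le)
  moreover have "(\<lambda>n. mean_sq_dist (emp (p n)) ys) \<longlonglongrightarrow> mean_sq_dist \<mu> ys"
    using tendsto_mean_sq_dist[OF ys] p(1) by (rule filterlim_compose)
  moreover have "\<bar>mean_sq_dist \<mu> ys - mean_sq_dist \<mu> ys\<bar> \<le> 2 * diameter K * \<epsilon>"
    using diameter_K_nonneg \<open>\<epsilon> > 0\<close> by simp
  ultimately show "\<exists>g b. g \<longlonglongrightarrow> b \<and> \<bar>b - mean_sq_dist \<mu> ys\<bar> \<le> 2 * diameter K * \<epsilon> \<and>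
      (\<forall>\<^sub>F n in sequentially. \<bar>mean_sq_dist (emp (p n)) (xs n) - g n\<bar> \<le> 2 * diameter K * \<epsilon>)"
    by (intro exI conjI)
qed (use diameter_K_nonneg in simp)

abbreviation sample_hull :: "nat \<Rightarrow> 'a set" where
  "sample_hull N \<equiv> convex hull (z ` {..<N})"

lemma sample_hull_subset: "sample_hull N \<subseteq> K"
  using sample_in by (intro hull_mono) auto

lemma sample_hull_mono: "m \<le> n \<Longrightarrow> sample_hull m \<subseteq> sample_hull n"
  by (intro hull_mono image_mono) auto

text \<open>An increasing union of convex sets is convex, and so is its closure; the closure
  contains \<open>S\<close> because the sample is dense there.\<close>

lemma K_subset_closure_sample_hulls: "K \<subseteq> closure (\<Union>N. sample_hull N)"
proof (rule hull_minimal)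
  have "convex (\<Union>N. sample_hull N)"
  proof (intro convexI)
    fix x y and u v :: real
    assume "x \<in> (\<Union>N. sample_hull N)" "y \<in> (\<Union>N. sample_hull N)" "0 \<le> u" "0 \<le> v" "u + v = 1"
    moreover from this obtain m n where "x \<in> sample_hull m" "y \<in> sample_hull n"
      by blast
    then have "x \<in> sample_hull (max m n)" "y \<in> sample_hull (max m n)"
      using sample_hull_mono[of m "max m n"] sample_hull_mono[of n "max m n"] by auto
    ultimately show "u *\<^sub>R x + v *\<^sub>R y \<in> (\<Union>N. sample_hull N)"
      using convexD[OF convex_convex_hull] by blast
  qed
  then show "convex (closure (\<Union>N. sample_hull N))"
    by (rule convex_closure)
  have "z i \<in> sample_hull (Suc i)" for i
    by (intro hull_inc) auto
  then have "range z \<subseteq> (\<Union>N. sample_hull N)"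
    by blast
  with sample_dense show "S \<subseteq> closure (\<Union>N. sample_hull N)"
    using closure_mono by blast
qed

text \<open>Once some sample hull has a point near \<open>b\<close>, all later hulls contain that
  point, and the projection of \<open>b\<close> is at least as close.\<close>

lemma closest_point_sample_hull_tendsto:
  assumes "b \<in> K"
  shows "(\<lambda>N. closest_point (sample_hull N) b) \<longlonglongrightarrow> b"
proof (rule tendstoI)
  fix \<epsilon> :: real assume "\<epsilon> > 0"
  moreover have "b \<in> closure (\<Union>N. sample_hull N)"
    using assms K_subset_closure_sample_hulls by blast
  ultimately obtain m y where y: "y \<in> sample_hull m" "dist y b < \<epsilon>"
    by (auto simp: closure_approachable)
  show "\<forall>\<^sub>F N in sequentially. dist (closest_point (sample_hull N) b) b < \<epsilon>"
    using eventually_ge_at_top[of m]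
  proof eventually_elim
    case (elim N)
    then have "y \<in> sample_hull N"
      using y(1) sample_hull_mono by blast
    then have "dist b (closest_point (sample_hull N) b) \<le> dist b y"
      by (intro closest_point_le compact_imp_closed finite_imp_compact_convex_hull) auto
    then show ?case
      using y(2) by (simp add: dist_commute)
  qed
qed

text \<open>Stated along an arbitrary index sequence \<open>q\<close>: this gives the existence of a
  convergent subsequence and also feeds the subsequence argument for the case of a unique
  solution.\<close>

theorem subsequence_tendsto_solution:
  assumes A: "\<And>N. N \<ge> 1 \<Longrightarrow> A N \<in> solutions k (emp N) (z ` {..<N})"
    and q: "strict_mono q" "\<And>n. q n \<ge> 1"
  obtains r L where "strict_mono (r :: nat \<Rightarrow> nat)" "L \<in> solutions k \<mu> S"
    "(\<lambda>n. d2inf (A (q (r n))) L) \<longlonglongrightarrow> 0"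
proof -
  have feasible: "size (A (q n)) = k" "set_mset (A (q n)) \<subseteq> sample_hull (q n)" for n
    using A[OF q(2)] by (auto simp: solutions_def is_arg_min_def)
  have optimal: "mean_sq_dist (emp (q n)) xs \<le> mean_sq_dist (emp (q n)) ys"
    if "mset xs = A (q n)" "length ys = k" "set ys \<subseteq> sample_hull (q n)" for n xs ys
  proof -
    have "\<not> Fobj (emp (q n)) (mset ys) < Fobj (emp (q n)) (mset xs)"
      using A[OF q(2), of n] that by (auto simp: solutions_def is_arg_min_def)
    then show ?thesis
      unfolding Fobj_mset by simp
  qed
  have "\<forall>n. \<exists>ys. mset ys = A (q n)"
    by (simp add: ex_mset)
  then obtain xs where xs: "\<And>n. mset (xs n) = A (q n)"
    by metis
  have len: "length (xs n) = k" and sub: "set (xs n) \<subseteq> K" for n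
    using feasible[of n] sample_hull_subset[of "q n"] unfolding xs[symmetric] by auto
  obtain r ys where r: "strict_mono (r :: nat \<Rightarrow> nat)" and ys: "length ys = k" "set ys \<subseteq> K"
    and lim: "\<forall>l<k. (\<lambda>n. xs (r n) ! l) \<longlonglongrightarrow> ys ! l"
    using compact_list_subsequence[where xs = xs, OF compact_K len sub] by blast
  have qr: "filterlim (\<lambda>n. q (r n)) sequentially sequentially"
    using strict_mono_o[OF q(1) r] by (auto simp: comp_def dest: filterlim_subseq)
  have lim_xs: "(\<lambda>n. mean_sq_dist (emp (q (r n))) (xs (r n))) \<longlonglongrightarrow> mean_sq_dist \<mu> ys"
    by (intro tendsto_mean_sq_dist_diagonal qr q len sub ys lim[rule_format])
  have "mean_sq_dist \<mu> ys \<le> mean_sq_dist \<mu> bs" if bs: "length bs = k" "set bs \<subseteq> K" for bs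
  proof -
    \<comment> \<open>The competitor \<open>bs\<close> lies in \<open>K\<close> but possibly outside
      the sample hull; its projections \<open>cs n\<close> are admissible for the empirical problem
      and converge to \<open>bs\<close>.\<close>
    define cs where "cs n = map (closest_point (sample_hull (q (r n)))) bs" for n
    \<comment> \<open>Here \<open>q (r n) \<ge> 1\<close> matters: projecting needs a nonempty
      hull.\<close>
    have "sample_hull (q (r n)) \<noteq> {}" for n
      using q(2)[of "r n"] by (auto simp: lessThan_empty_iff)
    then have cs_hull: "set (cs n) \<subseteq> sample_hull (q (r n))" for n
      by (auto simp: cs_def intro!: closest_point_in_set compact_imp_closed finite_imp_compact_convex_hull)
    have "set (cs n) \<subseteq> K" for n
      using cs_hull sample_hull_subset by blast
    moreover have "length (cs n) = k" for n
      by (simp add: cs_def bs)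
    moreover have "(\<lambda>n. cs n ! l) \<longlonglongrightarrow> bs ! l" if "l < k" for l
    proof -
      have "bs ! l \<in> K" using that bs nth_mem by blast
      from filterlim_compose[OF closest_point_sample_hull_tendsto[OF this] qr]
      show ?thesis using that bs by (simp add: cs_def)
    qed
    ultimately have lim_cs: "(\<lambda>n. mean_sq_dist (emp (q (r n))) (cs n)) \<longlonglongrightarrow> mean_sq_dist \<mu> bs"
      by (intro tendsto_mean_sq_dist_diagonal qr q bs)
    have "mean_sq_dist (emp (q (r n))) (xs (r n)) \<le> mean_sq_dist (emp (q (r n))) (cs n)" for n
      by (intro optimal xs cs_hull) (simp add: cs_def bs)
    then show ?thesis
      by (intro LIMSEQ_le[OF lim_xs lim_cs]) blast
  qed
  then have "\<not> Fobj \<mu> B < Fobj \<mu> (mset ys)" if "size B = k" "set_mset B \<subseteq> K" for B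
    using that ex_mset[of B] by (auto simp: Fobj_mset not_less)
  then have "mset ys \<in> solutions k \<mu> S"
    using ys by (auto simp: solutions_def is_arg_min_def)
  moreover have "(\<lambda>n. d2inf (A (q (r n))) (mset ys)) \<longlonglongrightarrow> 0"
    unfolding xs[symmetric] using k ys len lim by (intro tendsto_d2inf_mset) auto
  ultimately show ?thesis
    using that r by blast
qed

text \<open>Otherwise infinitely many indices keep the distance to \<open>A0\<close> outside a
  neighbourhood of 0. Along them a subsequence still converges to a solution, which can only be
  \<open>A0\<close>.\<close>

corollary tendsto_unique_solution:
  assumes A: "\<And>N. N \<ge> 1 \<Longrightarrow> A N \<in> solutions k (emp N) (z ` {..<N})"
    and unique: "solutions k \<mu> S = {A0}"
  shows "(\<lambda>N. d2inf (A N) A0) \<longlonglongrightarrow> 0"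
proof (rule ccontr)
  assume "\<not> (\<lambda>N. d2inf (A N) A0) \<longlonglongrightarrow> 0"
  then obtain U where U: "open U" "0 \<in> U" and "\<not> (\<forall>\<^sub>F N in sequentially. d2inf (A N) A0 \<in> U)"
    unfolding tendsto_def by blast
  then have freq: "\<exists>\<^sub>F N in sequentially. d2inf (A N) A0 \<notin> U"
    by (simp add: not_eventually)
  \<comment> \<open>Index 0 is excluded because \<open>A 0\<close> is unconstrained.\<close>
  have "infinite {N. N \<ge> 1 \<and> d2inf (A N) A0 \<notin> U}"
  proof -
    have "\<exists>\<^sub>F N in sequentially. N \<ge> 1 \<and> d2inf (A N) A0 \<notin> U"
      using frequently_eventually_conj[OF freq eventually_ge_at_top[of 1]] by simp
    then show ?thesis
      by (simp add: frequently_cofinite flip: cofinite_eq_sequentially)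
  qed
  then obtain q where q: "strict_mono (q :: nat \<Rightarrow> nat)" "\<And>n. q n \<ge> 1" "\<And>n. d2inf (A (q n)) A0 \<notin> U"
    using infinite_enumerate by blast
  obtain r L where "L \<in> solutions k \<mu> S" "(\<lambda>n. d2inf (A (q (r n))) L) \<longlonglongrightarrow> 0"
    using subsequence_tendsto_solution[OF A q(1,2)] by blast
  then have "\<forall>\<^sub>F n in sequentially. d2inf (A (q (r n))) A0 \<in> U"
    using U unique topological_tendstoD[of _ 0 sequentially U] by simp
  with q(3) show False by simp
qed

end

section \<open>Almost sure properties of the sample, and the conclusion\<close>

text \<open>Only countably many null sets are discarded: one for each list over a countable dense
  \<open>D\<close>, one for each sample index, and one for density of the sample. \<open>D\<close>
  is chosen before \<omega>.\<close>

lemma (in prob_space) AE_consistent_sample: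
  fixes X :: "nat \<Rightarrow> 'a \<Rightarrow> 'b::euclidean_space"
  assumes "k \<ge> 1" and compact: "compact (msupp \<mu>)"
    and indep: "indep_vars (\<lambda>_. borel) X UNIV"
    and distr: "\<And>i. distr M borel (X i) = \<mu>"
  obtains D where "AE \<omega> in M. consistent_sample k \<mu> (msupp \<mu>) D (\<lambda>i. X i \<omega>)"
proof -
  have X [measurable]: "random_variable borel (X i)" for i
    using indep unfolding indep_vars_def by blast
  have sets: "sets \<mu> = sets borel"
    unfolding distr[of 0, symmetric] by simp
  have prob: "prob_space \<mu>"
    unfolding distr[of 0, symmetric] by (rule prob_space_distr) (rule X)
  let ?K = "convex hull msupp \<mu>"
  have "compact ?K"
    using compact by (rule compact_convex_hull)
  have AE_supp: "AE x in \<mu>. x \<in> msupp \<mu>"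
    using sets by (rule AE_in_msupp)
  obtain D where D: "countable D" "D \<subseteq> ?K" "?K \<subseteq> closure D"
    by (rule separable)
  have "countable {ys. length ys = k \<and> set ys \<subseteq> D}"
    by (rule countable_subset[OF _ countable_lists[OF D(1)]]) auto
  moreover have "AE \<omega> in M. (\<lambda>N. (\<Sum>i<N. (infdist (X i \<omega>) (convex hull set ys))\<^sup>2) / real N)
      \<longlonglongrightarrow> mean_sq_dist \<mu> ys" if "length ys = k" "set ys \<subseteq> D" for ys
  proof (rule strong_law_bounded_function[OF indep distr, where a = 0])
    have ys: "ys \<noteq> []" "set ys \<subseteq> ?K"
      using that D(2) \<open>k \<ge> 1\<close> by auto
    \<comment> \<open>The added 1 keeps the interval nondegenerate, as the strong law requires, even
      if the diameter is 0.\<close>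
    have bound: "(infdist x (convex hull set ys))\<^sup>2 \<in> {0..(diameter ?K)\<^sup>2 + 1}" if "x \<in> msupp \<mu>" for x
    proof -
      have "(infdist x (convex hull set ys))\<^sup>2 \<le> (diameter ?K)\<^sup>2"
        using ys \<open>compact ?K\<close> hull_inc[OF that]
        by (intro power_mono infdist_convex_hull_le_diameter) (auto simp: infdist_nonneg)
      then show ?thesis by simp
    qed
    show "AE x in \<mu>. (infdist x (convex hull set ys))\<^sup>2 \<in> {0..(diameter ?K)\<^sup>2 + 1}"
      using AE_supp by (rule eventually_mono) (rule bound)
    show "0 < (diameter ?K)\<^sup>2 + 1"
      by (intro add_nonneg_pos) auto
  qed simp
  ultimately have "AE \<omega> in M. \<forall>ys\<in>{ys. length ys = k \<and> set ys \<subseteq> D}.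
      (\<lambda>N. (\<Sum>i<N. (infdist (X i \<omega>) (convex hull set ys))\<^sup>2) / real N) \<longlonglongrightarrow> mean_sq_dist \<mu> ys"
    by (subst AE_ball_countable) auto
  moreover have "AE \<omega> in M. \<forall>i. X i \<omega> \<in> msupp \<mu>"
    unfolding AE_all_countable
  proof
    fix i
    show "AE \<omega> in M. X i \<omega> \<in> msupp \<mu>"
      using AE_supp unfolding distr[of i, symmetric]
      by (subst (asm) AE_distr_iff) (auto simp: msupp_closed)
  qed
  moreover have "AE \<omega> in M. msupp \<mu> \<subseteq> closure (range (\<lambda>i. X i \<omega>))"
    using indep distr by (rule AE_msupp_subset_closure_sample)
  ultimately have "AE \<omega> in M. consistent_sample k \<mu> (msupp \<mu>) D (\<lambda>i. X i \<omega>)"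
  proof eventually_elim
    case (elim \<omega>)
    show ?case
    proof (rule consistent_sample.intro)
      show "range (\<lambda>i. X i \<omega>) \<subseteq> msupp \<mu>"
        using elim(2) by blast
      show "(\<lambda>N. (\<Sum>i<N. (infdist (X i \<omega>) (convex hull set ys))\<^sup>2) / real N) \<longlonglongrightarrow> mean_sq_dist \<mu> ys"
        if "length ys = k" "set ys \<subseteq> D" for ys
        using elim(1) that by blast
    qed (fact assms(1) prob sets compact AE_supp elim(3) D)+
  qed
  then show ?thesis ..
qed

text \<open>The exceptional null set comes from \<open>X\<close> alone; outside it both claims hold
  path by path, for any selection of minimisers, measurable in \<omega> or not.\<close>

theorem theorem1p5:
  fixes k :: nat
    and \<mu> :: "(real ^ 'd) measure"
    and M :: "'w measure"
    and X :: "nat \<Rightarrow> 'w \<Rightarrow> real ^ 'd"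
    and A :: "nat \<Rightarrow> 'w \<Rightarrow> (real ^ 'd) multiset"
  assumes "k \<ge> 1"
    and "prob_space \<mu>"
    and "compact (msupp \<mu>)"
    and "has_bounded_density \<mu>"
    and "prob_space M"
    and "prob_space.indep_vars M (\<lambda>_. borel) X UNIV"
    and "\<And>i. distr M borel (X i) = \<mu>"
    and "\<And>N \<omega>. N \<ge> 1 \<Longrightarrow> \<omega> \<in> space M \<Longrightarrow>
           A N \<omega> \<in> solutions k (empirical_measure N (\<lambda>i. X i \<omega>)) ((\<lambda>i. X i \<omega>) ` {..<N})"
  shows "(AE \<omega> in M. \<exists>r. strict_mono r \<and> (\<forall>m. r m \<ge> 1) \<and>
            (\<exists>L \<in> solutions k \<mu> (msupp \<mu>). (\<lambda>m. d2inf (A (r m) \<omega>) L) \<longlonglongrightarrow> 0))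
       \<and> (\<forall>A0. solutions k \<mu> (msupp \<mu>) = {A0} \<longrightarrow>
            (AE \<omega> in M. (\<lambda>N. d2inf (A N \<omega>) A0) \<longlonglongrightarrow> 0))"
proof -
  interpret prob_space M by fact
  obtain D where D: "AE \<omega> in M. consistent_sample k \<mu> (msupp \<mu>) D (\<lambda>i. X i \<omega>)"
    using AE_consistent_sample assms(1,3,6,7) by blast
  show ?thesis
  proof (intro conjI allI impI)
    show "AE \<omega> in M. \<exists>r. strict_mono r \<and> (\<forall>m. r m \<ge> 1) \<and>
            (\<exists>L \<in> solutions k \<mu> (msupp \<mu>). (\<lambda>m. d2inf (A (r m) \<omega>) L) \<longlonglongrightarrow> 0)"
      using D AE_space
    proof eventually_elim
      case (elim \<omega>)
      interpret consistent_sample k \<mu> "msupp \<mu>" D "\<lambda>i. X i \<omega>"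
        by (rule elim)
      \<comment> \<open>Taking \<open>q = Suc\<close> skips index 0, where \<open>A\<close> is
        unconstrained.\<close>
      obtain r L where "strict_mono r" "L \<in> solutions k \<mu> (msupp \<mu>)"
        "(\<lambda>n. d2inf (A (Suc (r n)) \<omega>) L) \<longlonglongrightarrow> 0"
        using subsequence_tendsto_solution[where A = "\<lambda>N. A N \<omega>" and q = Suc]
          assms(8) elim(2) strict_mono_Suc_iff[of Suc] by auto
      then show ?case
        by (intro exI[of _ "\<lambda>n. Suc (r n)"] conjI bexI[of _ L]) (auto simp: strict_mono_def)
    qed
  next
    fix A0 assume unique: "solutions k \<mu> (msupp \<mu>) = {A0}"
    show "AE \<omega> in M. (\<lambda>N. d2inf (A N \<omega>) A0) \<longlonglongrightarrow> 0"
      using D AE_space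
    proof eventually_elim
      case (elim \<omega>)
      interpret consistent_sample k \<mu> "msupp \<mu>" D "\<lambda>i. X i \<omega>"
        by (rule elim)
      show ?case
        using assms(8) elim(2) unique by (intro tendsto_unique_solution) auto
    qed
  qed
qed

end
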